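(* Let $\mathcal{H}_n$ be the Connes-Moscovici Hopf algebra and let $C$ be a finite dimensional right module coalgebra over $\mathcal{H}_n$ with non-trivial action. Then there is no total cointegral $f\colon C\to \mathcal{H}_n$ which is a coalgebra map.
   Context: An action is trivial if it is $ch=\varepsilon(h)c$. For a Hopf algebra $H$ and a right $H$-module coalgebra $C$, a total cointegral is a linear map $f\colon C\to H$ with $\varepsilon(f(c))=\varepsilon(c)$ and $f(ch)=f(c)h$. The Connes-Moscovici Hopf algebra $\mathcal{H}_n$ (over $\mathbb{C}$) is the standard one: on the frame bundle $F\mathbb{R}^n$ with coordinates $(x^\mu,y^\mu_j)$, $y\in GL_n(\mathbb{R})$, put $X_k=y^\mu_k\partial/\partial x^\mu$, $Y_i^j=y_i^\mu\partial/\partial y_j^\mu$. On the crossed product $C_c^\infty(F\mathbb{R}^n)\rtimes \mathrm{Diff}(\mathbb{R}^n)$, spanned by elements $gU_\phi^*$, let $X_k(gU_\phi^* )=X_k(g)U_\phi^*$, $Y_i^j(gU_\phi^* )=Y_i^j(g)U_\phi^*$ and $\delta^i_{jk}(gU_\phi^* )=\gamma^i_{jk}(\phi)gU_\phi^*$ with $\gamma^i_{jk}(\phi)(x,y)=(y^{-1}\phi'(x)^{-1}\partial_\mu\phi'(x)\,y)^i_j\,y^\mu_k$. $\mathcal{H}_n$ is the algebra of linear operators generated by all $X_k,Y_i^j,\delta^i_{jk}$, with coproduct determined by $h(ab)=h^{(1)}(a)h^{(2)}(b)$ and counit by $h(1)=\varepsilon(h)1$. *)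

theory Defs
  imports
    "HOL-Analysis.Analysis"
    "HOL-Library.Function_Algebras"
    "HOL-Library.Poly_Mapping"
begin

section \<open>Complex vector spaces\<close>

class complex_vector = ab_group_add +
  fixes scaleC :: "complex \<Rightarrow> 'a \<Rightarrow> 'a"  (infixr \<open>*\<^sub>C\<close> 75)
  assumes scaleC_add_right: "c *\<^sub>C (x + y) = c *\<^sub>C x + c *\<^sub>C y"
    and scaleC_add_left: "(c + d) *\<^sub>C x = c *\<^sub>C x + d *\<^sub>C x"
    and scaleC_scaleC: "c *\<^sub>C d *\<^sub>C x = (c * d) *\<^sub>C x"
    and scaleC_one: "1 *\<^sub>C x = x"

global_interpretation complex_vector: vector_space "scaleC :: complex \<Rightarrow> 'a \<Rightarrow> 'a::complex_vector"
  by unfold_locales (rule scaleC_add_right scaleC_add_left scaleC_scaleC scaleC_one)+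

abbreviation clinear :: "('a::complex_vector \<Rightarrow> 'b::complex_vector) \<Rightarrow> bool" where
  "clinear \<equiv> Vector_Spaces.linear scaleC scaleC"

definition cbilinear :: "('a::complex_vector \<Rightarrow> 'b::complex_vector \<Rightarrow> 'c::complex_vector) \<Rightarrow> bool" where
  "cbilinear B \<longleftrightarrow> (\<forall>a. clinear (B a)) \<and> (\<forall>b. clinear (\<lambda>a. B a b))"

instantiation complex :: complex_vector
begin
definition "scaleC_complex = ((*) :: complex \<Rightarrow> complex \<Rightarrow> complex)"
instance by standard (auto simp: scaleC_complex_def algebra_simps)
end

instantiation "fun" :: (type, complex_vector) complex_vector
begin
definition "scaleC_fun c f = (\<lambda>x. c *\<^sub>C f x)"
instance
  by standard
    (auto simp: scaleC_fun_def scaleC_add_right scaleC_add_left scaleC_scaleC scaleC_one)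
end

instantiation poly_mapping :: (type, complex_vector) complex_vector
begin
lift_definition scaleC_poly_mapping :: "complex \<Rightarrow> ('a \<Rightarrow>\<^sub>0 'b) \<Rightarrow> ('a \<Rightarrow>\<^sub>0 'b)"
  is "\<lambda>c f k. c *\<^sub>C f k"
  by (erule finite_subset[rotated]) auto
instance
  by standard
    (transfer; simp add: scaleC_add_right scaleC_add_left scaleC_scaleC scaleC_one fun_eq_iff)+
end


section \<open>The algebraic tensor product over the complex numbers\<close>

text \<open>The tensor product is the free vector space on pairs modulo the bilinearity relations.\<close>

definition tensor_relations :: "(('a::complex_vector \<times> 'b::complex_vector) \<Rightarrow>\<^sub>0 complex) set" where
  "tensor_relations =
     {Poly_Mapping.single (a + a', b) 1 - Poly_Mapping.single (a, b) 1 - Poly_Mapping.single (a', b) 1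
       | a a' b. True} \<union>
     {Poly_Mapping.single (a, b + b') 1 - Poly_Mapping.single (a, b) 1 - Poly_Mapping.single (a, b') 1
       | a b b'. True} \<union>
     {Poly_Mapping.single (c *\<^sub>C a, b) 1 - c *\<^sub>C Poly_Mapping.single (a, b) 1 | a b c. True} \<union>
     {Poly_Mapping.single (a, c *\<^sub>C b) 1 - c *\<^sub>C Poly_Mapping.single (a, b) 1 | a b c. True}"

definition tensor_eq ::
  "(('a::complex_vector \<times> 'b::complex_vector) \<Rightarrow>\<^sub>0 complex) \<Rightarrow> (('a \<times> 'b) \<Rightarrow>\<^sub>0 complex) \<Rightarrow> bool" where
  "tensor_eq p q \<longleftrightarrow> p - q \<in> complex_vector.span tensor_relations"

lemma equivp_tensor_eq: "equivp tensor_eq"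
proof (rule equivpI)
  show "reflp tensor_eq"
    by (auto simp: reflp_def tensor_eq_def complex_vector.span_zero)
  show "symp tensor_eq"
    unfolding symp_def tensor_eq_def
    by (metis complex_vector.span_neg minus_diff_eq)
  show "transp tensor_eq"
    unfolding transp_def tensor_eq_def
    by (auto dest: complex_vector.span_add)
qed

quotient_type (overloaded) ('a, 'b) tensor =
  "('a::complex_vector \<times> 'b::complex_vector) \<Rightarrow>\<^sub>0 complex" / tensor_eq
  by (rule equivp_tensor_eq)

instantiation tensor :: (complex_vector, complex_vector) complex_vector
begin

lift_definition zero_tensor :: "('a, 'b) tensor" is 0 .

lift_definition plus_tensor :: "('a, 'b) tensor \<Rightarrow> ('a, 'b) tensor \<Rightarrow> ('a, 'b) tensor" is "(+)"
  unfolding tensor_eq_def by (metis add_diff_add complex_vector.span_add)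

lift_definition uminus_tensor :: "('a, 'b) tensor \<Rightarrow> ('a, 'b) tensor" is uminus
  unfolding tensor_eq_def by (drule complex_vector.span_neg) (simp add: algebra_simps)

lift_definition minus_tensor :: "('a, 'b) tensor \<Rightarrow> ('a, 'b) tensor \<Rightarrow> ('a, 'b) tensor" is "(-)"
  unfolding tensor_eq_def
  by (drule (1) complex_vector.span_diff) (simp add: algebra_simps)

lift_definition scaleC_tensor :: "complex \<Rightarrow> ('a, 'b) tensor \<Rightarrow> ('a, 'b) tensor" is scaleC
  unfolding tensor_eq_def
  by (metis complex_vector.scale_right_diff_distrib complex_vector.span_scale)

instance
  by standard
    (transfer; simp add: tensor_eq_def complex_vector.span_zero algebra_simps
      scaleC_add_right scaleC_add_left scaleC_scaleC scaleC_one)+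

end

lift_definition pure_tensor :: "'a::complex_vector \<Rightarrow> 'b::complex_vector \<Rightarrow> ('a, 'b) tensor"
  (infixr \<open>\<otimes>\<^sub>\<complex>\<close> 70)
  is "\<lambda>a b. Poly_Mapping.single (a, b) 1" .

definition free_lift ::
  "('a \<Rightarrow> 'b \<Rightarrow> 'c::complex_vector) \<Rightarrow> (('a \<times> 'b) \<Rightarrow>\<^sub>0 complex) \<Rightarrow> 'c" where
  "free_lift B p = (\<Sum>(a, b)\<in>Poly_Mapping.keys p. Poly_Mapping.lookup p (a, b) *\<^sub>C B a b)"

text \<open>The map out of the tensor product induced by a bilinear map \<open>B\<close>; in Sweedler notation,
  \<open>tensor_lift B (\<Delta> c)\<close> is \<open>B c\<^sub>1 c\<^sub>2\<close>. It is evaluated on an arbitrary representative, which is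
  immaterial when \<open>B\<close> is bilinear: see \<open>tensor_lift_pure\<close> and \<open>clinear_tensor_lift\<close> below.\<close>

definition tensor_lift ::
  "('a \<Rightarrow> 'b \<Rightarrow> 'c::complex_vector) \<Rightarrow> ('a::complex_vector, 'b::complex_vector) tensor \<Rightarrow> 'c" where
  "tensor_lift B t = free_lift B (rep_tensor t)"

lemma free_lift_superset:
  assumes "finite S" "Poly_Mapping.keys p \<subseteq> S"
  shows "free_lift B p = (\<Sum>(a, b)\<in>S. Poly_Mapping.lookup p (a, b) *\<^sub>C B a b)"
  unfolding free_lift_def
  by (rule sum.mono_neutral_left) (use assms in \<open>auto simp: in_keys_iff\<close>)

lemma lookup_scaleC: "Poly_Mapping.lookup (c *\<^sub>C p) k = c *\<^sub>C Poly_Mapping.lookup p k"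
  by transfer simp

lemma free_lift_add: "free_lift B (p + q) = free_lift B p + free_lift B q"
proof -
  let ?S = "Poly_Mapping.keys p \<union> Poly_Mapping.keys q"
  have "Poly_Mapping.keys (p + q) \<subseteq> ?S" by (rule Poly_Mapping.keys_add)
  then show ?thesis
    by (simp add: free_lift_superset[of ?S] lookup_add scaleC_add_left case_prod_unfold
        sum.distrib)
qed

lemma free_lift_scaleC: "free_lift B (c *\<^sub>C p) = c *\<^sub>C free_lift B p"
proof -
  have "Poly_Mapping.keys (c *\<^sub>C p) \<subseteq> Poly_Mapping.keys p"
    by (auto simp: in_keys_iff lookup_scaleC)
  then show ?thesis
    by (simp add: free_lift_superset[of "Poly_Mapping.keys p"] lookup_scaleC case_prod_unfold
        complex_vector.scale_sum_right scaleC_scaleC scaleC_complex_def)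
qed

lemma clinear_free_lift: "clinear (free_lift B)"
  by unfold_locales (rule free_lift_add free_lift_scaleC)+

lemma free_lift_single: "free_lift B (Poly_Mapping.single (a, b) 1) = B a b"
  by (simp add: free_lift_def scaleC_one)

lemma free_lift_cong:
  assumes B: "cbilinear B" and "tensor_eq p q"
  shows "free_lift B p = free_lift B q"
proof -
  interpret F: Vector_Spaces.linear scaleC scaleC "free_lift B" by (rule clinear_free_lift)
  have L: "clinear (B a)" "clinear (\<lambda>a. B a b)" for a b
    using B by (auto simp: cbilinear_def)
  note L1 = Vector_Spaces.linear.axioms(3)[OF L(1)] Vector_Spaces.linear.axioms(3)[OF L(2)]
  have "free_lift B r = 0" if "r \<in> tensor_relations" for r
    using that L1[THEN module_hom.add] L1[THEN module_hom.scale]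
    by (auto simp: tensor_relations_def F.diff F.scale free_lift_single)
  then have "free_lift B (p - q) = 0"
    using assms(2) F.eq_0_on_span unfolding tensor_eq_def by blast
  then show ?thesis by (simp add: F.diff)
qed

lemma tensor_lift_abs:
  assumes "cbilinear B"
  shows "tensor_lift B (abs_tensor p) = free_lift B p"
  unfolding tensor_lift_def
  by (rule free_lift_cong[OF assms]) (rule Quotient3_rep_abs[OF Quotient3_tensor equivp_reflp[OF equivp_tensor_eq]])

lemma tensor_lift_pure:
  assumes "cbilinear B"
  shows "tensor_lift B (a \<otimes>\<^sub>\<complex> b) = B a b"
  by (simp add: pure_tensor.abs_eq tensor_lift_abs[OF assms] free_lift_single)

lemma clinear_tensor_lift:
  assumes "cbilinear B"
  shows "clinear (tensor_lift B)"
proof unfold_locales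
  fix s t
  show "tensor_lift B (s + t) = tensor_lift B s + tensor_lift B t"
    by (induct s rule: tensor.abs_induct, induct t rule: tensor.abs_induct)
      (simp add: plus_tensor.abs_eq tensor_lift_abs[OF assms] free_lift_add)
next
  fix c t
  show "tensor_lift B (c *\<^sub>C t) = c *\<^sub>C tensor_lift B t"
    by (induct t rule: tensor.abs_induct) (simp add: scaleC_tensor.abs_eq tensor_lift_abs[OF assms] free_lift_scaleC)
qed

definition tensor_map ::
  "('a::complex_vector \<Rightarrow> 'c::complex_vector) \<Rightarrow> ('b::complex_vector \<Rightarrow> 'd::complex_vector) \<Rightarrow>
    ('a, 'b) tensor \<Rightarrow> ('c, 'd) tensor" where
  "tensor_map f g = tensor_lift (\<lambda>a b. f a \<otimes>\<^sub>\<complex> g b)"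

definition tensor_assoc ::
  "(('a::complex_vector, 'b::complex_vector) tensor, 'c::complex_vector) tensor \<Rightarrow>
    ('a, ('b, 'c) tensor) tensor" where
  "tensor_assoc = tensor_lift (\<lambda>t c. tensor_lift (\<lambda>a b. a \<otimes>\<^sub>\<complex> (b \<otimes>\<^sub>\<complex> c)) t)"


section \<open>Coalgebras, module coalgebras and total cointegrals\<close>

locale coalgebra =
  fixes \<Delta> :: "'c::complex_vector \<Rightarrow> ('c, 'c) tensor" and \<epsilon> :: "'c \<Rightarrow> complex"
  assumes clinear_comult: "clinear \<Delta>"
    and clinear_counit: "clinear \<epsilon>"
    and coassoc: "tensor_assoc (tensor_map \<Delta> id (\<Delta> c)) = tensor_map id \<Delta> (\<Delta> c)"
    and counit_left: "tensor_lift (\<lambda>c\<^sub>1 c\<^sub>2. \<epsilon> c\<^sub>1 *\<^sub>C c\<^sub>2) (\<Delta> c) = c"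
    and counit_right: "tensor_lift (\<lambda>c\<^sub>1 c\<^sub>2. \<epsilon> c\<^sub>2 *\<^sub>C c\<^sub>1) (\<Delta> c) = c"

text \<open>The Hopf algebra acting on \<open>C\<close> is the type \<open>'h\<close> with its multiplication and unit, and with
  comultiplication \<open>\<Delta>\<^sub>H\<close> and counit \<open>\<epsilon>\<^sub>H\<close>; its axioms are not repeated here.\<close>

locale right_module_coalgebra = coalgebra \<Delta> \<epsilon>
  for \<Delta> :: "'c::complex_vector \<Rightarrow> ('c, 'c) tensor" and \<epsilon> :: "'c \<Rightarrow> complex" +
  fixes \<Delta>\<^sub>H :: "'h::{complex_vector, times, one} \<Rightarrow> ('h, 'h) tensor"
    and \<epsilon>\<^sub>H :: "'h \<Rightarrow> complex"
    and act :: "'c \<Rightarrow> 'h \<Rightarrow> 'c"  (infixl \<open>\<triangleleft>\<close> 72)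
  assumes cbilinear_act: "cbilinear act"
    and act_one: "c \<triangleleft> 1 = c"
    and act_mult: "c \<triangleleft> (g * h) = (c \<triangleleft> g) \<triangleleft> h"
    and comult_act: "\<Delta> (c \<triangleleft> h) =
      tensor_lift (\<lambda>c\<^sub>1 c\<^sub>2. tensor_lift (\<lambda>h\<^sub>1 h\<^sub>2. (c\<^sub>1 \<triangleleft> h\<^sub>1) \<otimes>\<^sub>\<complex> (c\<^sub>2 \<triangleleft> h\<^sub>2)) (\<Delta>\<^sub>H h)) (\<Delta> c)"
    and counit_act: "\<epsilon> (c \<triangleleft> h) = \<epsilon> c * \<epsilon>\<^sub>H h"

definition trivial_action :: "('h \<Rightarrow> complex) \<Rightarrow> ('c::complex_vector \<Rightarrow> 'h \<Rightarrow> 'c) \<Rightarrow> bool" where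
  "trivial_action \<epsilon>\<^sub>H act \<longleftrightarrow> (\<forall>c h. act c h = \<epsilon>\<^sub>H h *\<^sub>C c)"

definition total_cointegral ::
  "('h::{complex_vector, times} \<Rightarrow> complex) \<Rightarrow> ('c::complex_vector \<Rightarrow> complex) \<Rightarrow> ('c \<Rightarrow> 'h \<Rightarrow> 'c) \<Rightarrow>
    ('c \<Rightarrow> 'h) \<Rightarrow> bool" where
  "total_cointegral \<epsilon>\<^sub>H \<epsilon> act f \<longleftrightarrow>
     clinear f \<and> (\<forall>c. \<epsilon>\<^sub>H (f c) = \<epsilon> c) \<and> (\<forall>c h. f (act c h) = f c * h)"

definition coalgebra_map ::
  "('c::complex_vector \<Rightarrow> ('c, 'c) tensor) \<Rightarrow> ('c \<Rightarrow> complex) \<Rightarrow>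
    ('d::complex_vector \<Rightarrow> ('d, 'd) tensor) \<Rightarrow> ('d \<Rightarrow> complex) \<Rightarrow> ('c \<Rightarrow> 'd) \<Rightarrow> bool" where
  "coalgebra_map \<Delta> \<epsilon> \<Delta>' \<epsilon>' f \<longleftrightarrow>
     clinear f \<and> (\<forall>c. \<Delta>' (f c) = tensor_map f f (\<Delta> c)) \<and> (\<forall>c. \<epsilon>' (f c) = \<epsilon> c)"

definition finite_dimensional :: "'c::complex_vector itself \<Rightarrow> bool" where
  "finite_dimensional _ \<longleftrightarrow> (\<exists>B :: 'c set. finite B \<and> complex_vector.span B = UNIV)"


section \<open>The crossed product algebra of the frame bundle by diffeomorphisms\<close>

text \<open>\<open>C\<^sup>k\<close> maps, through iterated directional derivatives.\<close>

primrec C_k :: "nat \<Rightarrow> ('a::real_normed_vector \<Rightarrow> 'b::real_normed_vector) \<Rightarrow> bool" where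
  "C_k 0 f \<longleftrightarrow> continuous_on UNIV f"
| "C_k (Suc k) f \<longleftrightarrow>
     (\<forall>x. f differentiable (at x)) \<and> (\<forall>v. C_k k (\<lambda>x. frechet_derivative f (at x) v))"

definition smooth :: "('a::real_normed_vector \<Rightarrow> 'b::real_normed_vector) \<Rightarrow> bool" where
  "smooth f \<longleftrightarrow> (\<forall>k. C_k k f)"

definition diffeomorphisms :: "(real^'n \<Rightarrow> real^'n) set" where
  "diffeomorphisms = {\<phi>. bij \<phi> \<and> smooth \<phi> \<and> smooth (inv \<phi>)}"

text \<open>Coordinates \<open>(x, y)\<close>: the entry \<open>y\<^sup>\<mu>\<^sub>j\<close> is \<open>y $ \<mu> $ j\<close>, with upper indices for rows.\<close>

type_synonym 'n coord = "(real^'n) \<times> (real^'n^'n)"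

definition frame_bundle :: "'n::finite coord set" where
  "frame_bundle = {(x, y). invertible y}"

text \<open>Smooth functions with compact support in the open set \<^const>\<open>frame_bundle\<close>, extended by zero.\<close>

definition test_functions :: "('n::finite coord \<Rightarrow> complex) set" where
  "test_functions =
     {g. smooth g \<and> (\<exists>K. compact K \<and> K \<subseteq> frame_bundle \<and> (\<forall>u. u \<notin> K \<longrightarrow> g u = 0))}"

text \<open>The lift \<open>(x, y) \<mapsto> (\<phi> x, \<phi>' x y)\<close> to the frame bundle.\<close>

definition frame_lift :: "(real^'n \<Rightarrow> real^'n) \<Rightarrow> 'n::finite coord \<Rightarrow> 'n coord" where
  "frame_lift \<phi> = (\<lambda>(x, y). (\<phi> x, jacobian \<phi> (at x) ** y))"

text \<open>A finite sum \<open>\<Sum>\<phi>. a\<^sub>\<phi> U\<^sub>\<phi>\<^sup>*\<close> is represented by the family of its coefficients.\<close>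

type_synonym 'n family = "(real^'n \<Rightarrow> real^'n) \<Rightarrow> 'n coord \<Rightarrow> complex"

definition crossed_product :: "'n::finite family set" where
  "crossed_product =
     {a. finite {\<phi>. a \<phi> \<noteq> 0} \<and> {\<phi>. a \<phi> \<noteq> 0} \<subseteq> diffeomorphisms \<and> (\<forall>\<phi>. a \<phi> \<in> test_functions)}"

definition monomial :: "('n coord \<Rightarrow> complex) \<Rightarrow> (real^'n \<Rightarrow> real^'n) \<Rightarrow> 'n::finite family" where
  "monomial g \<phi> = (\<lambda>\<psi>. if \<psi> = \<phi> then g else 0)"

text \<open>The rule \<open>(g U\<^sub>\<phi>\<^sup>*) (g' U\<^sub>\<psi>\<^sup>*) = g (g' \<circ> \<phi>~) U\<^sub>\<psi>\<^sub>\<phi>\<^sup>*\<close>, where \<open>\<phi>~\<close> is the lift of \<open>\<phi>\<close>, extended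
  bilinearly.\<close>

definition crossed_mult :: "'n::finite family \<Rightarrow> 'n family \<Rightarrow> 'n family"  (infixl \<open>\<star>\<close> 70) where
  "a \<star> b = (\<Sum>\<phi> | a \<phi> \<noteq> 0. \<Sum>\<psi> | b \<psi> \<noteq> 0.
     monomial (\<lambda>u. a \<phi> u * b \<psi> (frame_lift \<phi> u)) (\<psi> \<circ> \<phi>))"


section \<open>The Connes-Moscovici Hopf algebra\<close>

definition vector_X :: "'n::finite \<Rightarrow> ('n coord \<Rightarrow> complex) \<Rightarrow> 'n coord \<Rightarrow> complex" where
  "vector_X k g = (\<lambda>(x, y).
     \<Sum>\<mu>\<in>UNIV. of_real (y $ \<mu> $ k) * frechet_derivative g (at (x, y)) (axis \<mu> 1, 0))"

definition vector_Y :: "'n::finite \<Rightarrow> 'n \<Rightarrow> ('n coord \<Rightarrow> complex) \<Rightarrow> 'n coord \<Rightarrow> complex" where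
  "vector_Y i j g = (\<lambda>(x, y).
     \<Sum>\<mu>\<in>UNIV. of_real (y $ \<mu> $ i) * frechet_derivative g (at (x, y)) (0, axis \<mu> (axis j 1)))"

definition gamma :: "'n \<Rightarrow> 'n \<Rightarrow> 'n \<Rightarrow> (real^'n \<Rightarrow> real^'n) \<Rightarrow> 'n::finite coord \<Rightarrow> real" where
  "gamma i j k \<phi> = (\<lambda>(x, y).
     \<Sum>\<mu>\<in>UNIV.
       (matrix_inv y ** matrix_inv (jacobian \<phi> (at x)) **
          frechet_derivative (\<lambda>z. jacobian \<phi> (at z)) (at x) (axis \<mu> 1) ** y) $ i $ j
        * y $ \<mu> $ k)"

text \<open>An operator on \<^const>\<open>crossed_product\<close> is represented by a map vanishing outside it, so that
  equality of such maps is equality of operators.\<close>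

type_synonym 'n operator = "'n family \<Rightarrow> 'n family"

definition on_crossed_product :: "'n::finite operator \<Rightarrow> 'n operator" where
  "on_crossed_product T = (\<lambda>a. if a \<in> crossed_product then T a else 0)"

definition op_X :: "'n::finite \<Rightarrow> 'n operator" where
  "op_X k = on_crossed_product (\<lambda>a \<phi>. vector_X k (a \<phi>))"

definition op_Y :: "'n::finite \<Rightarrow> 'n \<Rightarrow> 'n operator" where
  "op_Y i j = on_crossed_product (\<lambda>a \<phi>. vector_Y i j (a \<phi>))"

definition op_delta :: "'n::finite \<Rightarrow> 'n \<Rightarrow> 'n \<Rightarrow> 'n operator" where
  "op_delta i j k = on_crossed_product (\<lambda>a \<phi> u. of_real (gamma i j k \<phi> u) * a \<phi> u)"

inductive_set CM_operators :: "'n::finite operator set" where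
  one: "on_crossed_product id \<in> CM_operators"
| X: "op_X k \<in> CM_operators"
| Y: "op_Y i j \<in> CM_operators"
| delta: "op_delta i j k \<in> CM_operators"
| add: "S \<in> CM_operators \<Longrightarrow> T \<in> CM_operators \<Longrightarrow> S + T \<in> CM_operators"
| scale: "T \<in> CM_operators \<Longrightarrow> c *\<^sub>C T \<in> CM_operators"
| comp: "S \<in> CM_operators \<Longrightarrow> T \<in> CM_operators \<Longrightarrow> S \<circ> T \<in> CM_operators"

typedef (overloaded) ('n::finite) CM_Hopf = "CM_operators :: 'n operator set"
  morphisms operator_of Abs_CM_Hopf
  using CM_operators.one by blast

setup_lifting type_definition_CM_Hopf

lemma CM_operators_zero: "0 \<in> CM_operators"
  using CM_operators.scale[OF CM_operators.one, of 0] by simp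

lemma CM_operators_uminus: "T \<in> CM_operators \<Longrightarrow> - T \<in> CM_operators"
  using CM_operators.scale[of T "-1"] by (simp add: scaleC_one)

lemma CM_operators_minus: "S \<in> CM_operators \<Longrightarrow> T \<in> CM_operators \<Longrightarrow> S - T \<in> CM_operators"
  unfolding diff_conv_add_uminus by (intro CM_operators.add CM_operators_uminus)

instantiation CM_Hopf :: (finite) "{complex_vector, times, one}"
begin

lift_definition zero_CM_Hopf :: "'a CM_Hopf" is 0 by (rule CM_operators_zero)
lift_definition plus_CM_Hopf :: "'a CM_Hopf \<Rightarrow> 'a CM_Hopf \<Rightarrow> 'a CM_Hopf" is "(+)"
  by (rule CM_operators.add)
lift_definition uminus_CM_Hopf :: "'a CM_Hopf \<Rightarrow> 'a CM_Hopf" is uminus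
  by (rule CM_operators_uminus)
lift_definition minus_CM_Hopf :: "'a CM_Hopf \<Rightarrow> 'a CM_Hopf \<Rightarrow> 'a CM_Hopf" is "(-)"
  by (rule CM_operators_minus)
lift_definition scaleC_CM_Hopf :: "complex \<Rightarrow> 'a CM_Hopf \<Rightarrow> 'a CM_Hopf" is scaleC
  by (rule CM_operators.scale)
lift_definition one_CM_Hopf :: "'a CM_Hopf" is "on_crossed_product id"
  by (rule CM_operators.one)
lift_definition times_CM_Hopf :: "'a CM_Hopf \<Rightarrow> 'a CM_Hopf \<Rightarrow> 'a CM_Hopf" is "(\<circ>)"
  by (rule CM_operators.comp)

instance
  by standard
    (transfer; simp add: algebra_simps scaleC_add_right scaleC_add_left scaleC_scaleC scaleC_one)+

end

text \<open>The coproduct is determined by \<open>h (a b) = h\<^sub>1 a h\<^sub>2 b\<close>.\<close>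

definition CM_comult :: "'n::finite CM_Hopf \<Rightarrow> ('n CM_Hopf, 'n CM_Hopf) tensor" where
  "CM_comult h = (THE t. \<forall>a\<in>crossed_product. \<forall>b\<in>crossed_product.
     operator_of h (a \<star> b) = tensor_lift (\<lambda>h\<^sub>1 h\<^sub>2. operator_of h\<^sub>1 a \<star> operator_of h\<^sub>2 b) t)"

text \<open>The counit is determined by \<open>h 1 = \<epsilon> h 1\<close>. The unit, which is the constant function \<open>1\<close>
  times \<open>U\<^sub>i\<^sub>d\<^sup>*\<close>, does not have compact support; as the operators are local, their value on it
  near a point \<open>u\<close> is found by applying them to \<open>\<eta> U\<^sub>i\<^sub>d\<^sup>*\<close> with \<open>\<eta> = 1\<close> near \<open>u\<close>.\<close>

definition CM_counit :: "'n::finite CM_Hopf \<Rightarrow> complex" where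
  "CM_counit h = (THE e. \<forall>\<eta>\<in>test_functions. \<forall>u\<in>frame_bundle.
     (\<forall>\<^sub>F v in nhds u. \<eta> v = 1) \<longrightarrow>
       (\<forall>\<psi>. operator_of h (monomial \<eta> id) \<psi> u = monomial (\<lambda>_. e) id \<psi> u))"

end

theory Submission
  imports Defs "HOL-Real_Asymp.Real_Asymp"
begin

text \<open>A total cointegral \<open>f\<close> maps \<open>C\<close> onto a finite-dimensional right ideal of the Hopf algebra,
  since \<open>f c h = f (c h)\<close>. The counit vanishes on every such ideal. Indeed, let \<open>h\<close> lie in the ideal
  and let \<open>X\<close> be one of the operators \<open>X\<^sub>k\<close>. The elements \<open>h X\<^sup>j\<close> of the ideal are linearly dependent, so
  \<open>h p(X) = 0\<close> for some \<open>p(X) = a\<^sub>m X\<^sup>m + \<dots> + a\<^sub>N X\<^sup>N\<close> with \<open>a\<^sub>m \<noteq> 0\<close>. Near a frame \<open>u\<close> the vector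
  field \<open>X\<close> can be straightened: there is a function \<open>t\<close> with \<open>X t = 1\<close>. Let \<open>w\<close> be a test function
  that agrees with \<open>t\<^sup>m\<close> near \<open>u\<close>. Then \<open>p(X) w\<close> is the constant \<open>a\<^sub>m m!\<close> near \<open>u\<close>, and \<open>h\<close> multiplies a
  locally constant function by \<open>\<epsilon> h\<close>. Hence \<open>\<epsilon> h \<cdot> a\<^sub>m m! = 0\<close>, which forces \<open>\<epsilon> h = 0\<close>
  (\<open>CM_counit_eq_0_if_annihilates_polynomial\<close>).

  It follows that \<open>\<epsilon> c = \<epsilon> (f c) = 0\<close> for all \<open>c\<close>. The counit axiom \<open>\<epsilon> c\<^sub>1 c\<^sub>2 = c\<close> then gives
  \<open>C = 0\<close>, and on the zero space every action is trivial.

  The argument rests on two facts. Smooth cutoff functions exist (\<open>smooth_cutoff\<close>); they are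
  also what makes the counit unique. Every operator in the algebra maps \<open>g U\<^sub>i\<^sub>d\<^sup>*\<close> to some
  \<open>g' U\<^sub>i\<^sub>d\<^sup>*\<close>, and \<open>g'\<close> is \<open>e c\<close> wherever \<open>g\<close> is locally a constant \<open>c\<close>, for a number \<open>e\<close> that depends
  on the operator alone (\<open>CM_operators_act_on_unit\<close>); this number is the counit.\<close>

section \<open>Smooth functions\<close>

lemma C_k_SucI:
  assumes "\<And>x. (f has_derivative f' x) (at x)" "\<And>v. C_k k (\<lambda>x. f' x v)"
  shows "C_k (Suc k) f"
proof -
  have "frechet_derivative f (at x) = f' x" for x
    using frechet_derivative_at[OF assms(1)] by simp
  then show ?thesis using assms by (auto simp: differentiable_def)
qed

lemma C_k_Suc_has_derivative:
  assumes "C_k (Suc k) f"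
  shows "(f has_derivative frechet_derivative f (at x)) (at x)"
  using assms by (auto simp: frechet_derivative_works)

lemma C_k_Suc_imp_C_k: "C_k (Suc k) f \<Longrightarrow> C_k k f"
proof (induction k arbitrary: f)
  case 0
  then show ?case
    by (auto intro!: differentiable_imp_continuous_on differentiable_at_imp_differentiable_on)
next
  case (Suc k)
  from Suc.prems have "C_k (Suc k) (\<lambda>x. frechet_derivative f (at x) v)" for v by simp
  with Suc have "C_k k (\<lambda>x. frechet_derivative f (at x) v)" for v by blast
  with Suc.prems show ?case by simp
qed

lemma C_k_const: "C_k k (\<lambda>x. c)"
  by (induction k arbitrary: c) auto

lemma C_k_bounded_linear:
  assumes "bounded_linear L"
  shows "C_k k L"
proof (cases k)
  case 0
  then show ?thesis using assms by (simp add: linear_continuous_on)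
next
  case (Suc m)
  show ?thesis unfolding Suc
    by (rule C_k_SucI[where f' = "\<lambda>x. L"])
      (auto intro: bounded_linear_imp_has_derivative assms C_k_const)
qed

lemma C_k_add: "C_k k f \<Longrightarrow> C_k k g \<Longrightarrow> C_k k (\<lambda>x. f x + g x)"
proof (induction k arbitrary: f g)
  case 0
  then show ?case by (simp add: continuous_on_add)
next
  case (Suc k)
  show ?case
  proof (rule C_k_SucI)
    show "((\<lambda>x. f x + g x) has_derivative
        (\<lambda>v. frechet_derivative f (at x) v + frechet_derivative g (at x) v)) (at x)" for x
      using Suc.prems by (intro has_derivative_add C_k_Suc_has_derivative)
    show "C_k k (\<lambda>x. frechet_derivative f (at x) v + frechet_derivative g (at x) v)" for v
      using Suc.prems by (intro Suc.IH) auto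
  qed
qed

lemma C_k_sum: "(\<And>i. i \<in> I \<Longrightarrow> C_k k (f i)) \<Longrightarrow> C_k k (\<lambda>x. \<Sum>i\<in>I. f i x)"
  by (induction I rule: infinite_finite_induct) (auto intro: C_k_add C_k_const)

lemma C_k_bounded_linear_compose:
  assumes L: "bounded_linear L"
  shows "C_k k f \<Longrightarrow> C_k k (\<lambda>x. L (f x))"
proof (induction k arbitrary: f)
  case 0
  then show ?case using L by (simp add: bounded_linear.continuous_on)
next
  case (Suc k)
  show ?case
  proof (rule C_k_SucI)
    show "((\<lambda>x. L (f x)) has_derivative (\<lambda>v. L (frechet_derivative f (at x) v))) (at x)" for x
      by (rule bounded_linear.has_derivative[OF L C_k_Suc_has_derivative[OF Suc.prems]])
    show "C_k k (\<lambda>x. L (frechet_derivative f (at x) v))" for v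
      using Suc.prems by (intro Suc.IH) auto
  qed
qed

lemma C_k_mult:
  fixes f g :: "'a::real_normed_vector \<Rightarrow> 'b::real_normed_algebra"
  shows "C_k k f \<Longrightarrow> C_k k g \<Longrightarrow> C_k k (\<lambda>x. f x * g x)"
proof (induction k arbitrary: f g)
  case 0
  then show ?case by (simp add: continuous_on_mult)
next
  case (Suc k)
  show ?case
  proof (rule C_k_SucI)
    show "((\<lambda>x. f x * g x) has_derivative
        (\<lambda>v. f x * frechet_derivative g (at x) v + frechet_derivative f (at x) v * g x)) (at x)" for x
      using Suc.prems by (intro has_derivative_mult C_k_Suc_has_derivative)
    show "C_k k (\<lambda>x. f x * frechet_derivative g (at x) v + frechet_derivative f (at x) v * g x)" for v
      using Suc.prems by (intro C_k_add Suc.IH) (auto dest: C_k_Suc_imp_C_k simp del: C_k.simps(2), auto)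
  qed
qed

lemma C_k_uminus: "C_k k f \<Longrightarrow> C_k k (\<lambda>x. - f x)"
  by (rule C_k_bounded_linear_compose) (rule bounded_linear_minus[OF bounded_linear_ident])

lemma C_k_power:
  fixes f :: "'a::real_normed_vector \<Rightarrow> 'b::real_normed_algebra_1"
  shows "C_k k f \<Longrightarrow> C_k k (\<lambda>x. f x ^ n)"
  by (induction n) (auto intro: C_k_mult C_k_const)

lemma C_k_inverse:
  fixes f :: "'a::real_normed_vector \<Rightarrow> 'b::real_normed_div_algebra"
  assumes nz: "\<And>x. f x \<noteq> 0"
  shows "C_k k f \<Longrightarrow> C_k k (\<lambda>x. inverse (f x))"
proof (induction k)
  case 0
  then show ?case using nz by (auto intro: continuous_on_inverse)
next
  case (Suc k)
  have "C_k k (\<lambda>x. inverse (f x))"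
    by (rule Suc.IH) (rule C_k_Suc_imp_C_k[OF Suc.prems])
  then have "C_k k (\<lambda>x. - (inverse (f x) * frechet_derivative f (at x) v * inverse (f x)))" for v
    using Suc.prems by (intro C_k_uminus C_k_mult) auto
  then show ?case
    by (rule C_k_SucI[rotated])
      (rule Deriv.has_derivative_inverse[OF nz C_k_Suc_has_derivative[OF Suc.prems]])
qed


section \<open>A smooth cutoff function\<close>

text \<open>The classical flat function \<open>exp (- 1 / t)\<close> alone is not closed under differentiation; its
  multiples by powers of \<open>1 / t\<close> span a space that is, and this yields all derivatives at once.\<close>

definition flat :: "nat \<Rightarrow> real \<Rightarrow> real" where
  "flat n t = (if t > 0 then (1 / t) ^ n * exp (- 1 / t) else 0)"

lemma flat_tendsto_0: "(flat n \<longlongrightarrow> 0) (at_right 0)"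
proof (rule Lim_transform_eventually)
  show "((\<lambda>t. (1 / t) ^ n * exp (- 1 / t)) \<longlongrightarrow> (0::real)) (at_right 0)"
    by real_asymp
  show "\<forall>\<^sub>F t in at_right 0. (1 / t) ^ n * exp (- 1 / t) = flat n t"
    by (auto simp: eventually_at_right_less flat_def eventually_at_filter)
qed

text \<open>At \<open>0\<close> the difference quotient of \<open>flat n\<close> is \<open>flat (Suc n)\<close>, which tends to \<open>0\<close> from the right
  because the exponential beats every power.\<close>

lemma DERIV_flat:
  "(flat n has_real_derivative (flat (Suc (Suc n)) t - n * flat (Suc n) t)) (at t)"
proof (cases t "0::real" rule: linorder_cases)
  case less
  have "(flat n has_real_derivative 0) (at t)"
    by (rule has_field_derivative_transform_within_open[where f = "\<lambda>_. 0" and S = "{..<0}"])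
      (use less in \<open>auto simp: flat_def\<close>)
  then show ?thesis using less by (simp add: flat_def)
next
  case equal
  have quot: "flat n h / h = flat (Suc n) h" for h
    by (simp add: flat_def)
  have "((\<lambda>h. flat n h / h) \<longlongrightarrow> 0) (at_left 0)"
    by (rule tendsto_eventually) (auto simp: flat_def eventually_at_filter)
  moreover have "((\<lambda>h. flat n h / h) \<longlongrightarrow> 0) (at_right 0)"
    unfolding quot by (rule flat_tendsto_0)
  ultimately have "((\<lambda>h. flat n h / h) \<longlongrightarrow> 0) (at 0)"
    by (simp add: filterlim_at_split)
  then show ?thesis using equal by (simp add: DERIV_def flat_def)
next
  case greater
  have "((\<lambda>t. 1 / t) has_real_derivative - (1 / t)\<^sup>2) (at t)"
    using greater by (auto intro!: derivative_eq_intros simp: power2_eq_square)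
  from DERIV_power[OF this, of n]
  have "((\<lambda>t. (1 / t) ^ n) has_real_derivative - (n * (1 / t) ^ Suc n)) (at t)"
    by (rule DERIV_cong) (cases n; simp add: power2_eq_square)
  moreover have "((\<lambda>t. exp (- 1 / t)) has_real_derivative (1 / t)\<^sup>2 * exp (- 1 / t)) (at t)"
    using greater by (auto intro!: derivative_eq_intros simp: power2_eq_square)
  ultimately have "((\<lambda>t. (1 / t) ^ n * exp (- 1 / t)) has_real_derivative
      (1 / t) ^ Suc (Suc n) * exp (- 1 / t) - n * ((1 / t) ^ Suc n * exp (- 1 / t))) (at t)"
    by (rule DERIV_mult[THEN DERIV_cong]) (simp add: power2_eq_square algebra_simps)
  then have "(flat n has_real_derivative
      (1 / t) ^ Suc (Suc n) * exp (- 1 / t) - n * ((1 / t) ^ Suc n * exp (- 1 / t))) (at t)"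
    by (rule has_field_derivative_transform_within_open[where S = "{0<..}"])
      (use greater in \<open>auto simp: flat_def\<close>)
  then show ?thesis using greater by (simp add: flat_def)
qed

lemma C_k_flat: "C_k k g \<Longrightarrow> C_k k (\<lambda>x. flat n (g x))"
proof (induction k arbitrary: n g)
  case 0
  have "continuous_on UNIV (flat n)"
    using DERIV_flat by (meson DERIV_isCont continuous_at_imp_continuous_on)
  then show ?case using 0 continuous_on_compose2[of UNIV "flat n" UNIV g] by simp
next
  case (Suc k)
  show ?case
  proof (rule C_k_SucI)
    show "((\<lambda>x. flat n (g x)) has_derivative (\<lambda>v. (flat (Suc (Suc n)) (g x) + (- n) * flat (Suc n) (g x))
        * frechet_derivative g (at x) v)) (at x)" for x
      using has_derivative_compose[OF C_k_Suc_has_derivative[OF Suc.prems]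
          DERIV_flat[of n, unfolded has_field_derivative_def]] by simp
    have "C_k k g" by (rule C_k_Suc_imp_C_k[OF Suc.prems])
    then show "C_k k (\<lambda>x. (flat (Suc (Suc n)) (g x) + (- n) * flat (Suc n) (g x))
        * frechet_derivative g (at x) v)" for v
      using Suc.prems by (intro C_k_mult C_k_add C_k_const Suc.IH) auto
  qed
qed

text \<open>With \<open>s\<close> the squared distance from \<open>u\<close>, which is smooth, the cutoff is the quotient
  \<open>p / (p + q)\<close>, where \<open>p = flat 0 (e\<^sup>2 - s)\<close> is supported where \<open>s \<le> e\<^sup>2\<close> and
  \<open>q = flat 0 (s - (e / 2)\<^sup>2)\<close> where \<open>s \<ge> (e / 2)\<^sup>2\<close>; at every point at least one of them is positive.\<close>

lemma smooth_cutoff: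
  fixes u :: "'a::euclidean_space"
  assumes "e > 0"
  obtains \<beta> :: "'a \<Rightarrow> real"
    where "smooth \<beta>" "\<And>z. 0 \<le> \<beta> z" "\<And>z. \<beta> z \<le> 1"
      "\<forall>\<^sub>F z in nhds u. \<beta> z = 1" "\<And>z. z \<notin> cball u e \<Longrightarrow> \<beta> z = 0"
proof -
  define s where "s z = (\<Sum>b\<in>Basis. (z \<bullet> b + - (u \<bullet> b)) * (z \<bullet> b + - (u \<bullet> b)))" for z
  have s: "s z = (dist u z)\<^sup>2" for z
    unfolding s_def dist_norm power2_norm_eq_inner euclidean_inner[of "u - z" "u - z"]
    by (simp add: inner_diff_left algebra_simps)
  have C_s: "C_k k s" for k
    unfolding s_def
    by (intro C_k_sum C_k_mult C_k_add C_k_const C_k_bounded_linear bounded_linear_inner_left)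
  define p where "p z = flat 0 (e\<^sup>2 + - s z)" for z
  define q where "q z = flat 0 (s z + - ((e / 2)\<^sup>2))" for z
  have C_pq: "C_k k p" "C_k k q" for k
    unfolding p_def q_def
    by (intro C_k_flat C_k_add C_k_const C_k_uminus C_s)+
  have nonneg: "p z \<ge> 0" "q z \<ge> 0" for z by (auto simp: p_def q_def flat_def)
  have "(e / 2)\<^sup>2 < e\<^sup>2" using assms by (intro power_strict_mono) auto
  then have "p z > 0 \<or> q z > 0" for z
    by (auto simp: p_def q_def flat_def)
  with nonneg have pos: "p z + q z > 0" for z
    by (meson add_nonneg_pos add_pos_nonneg)
  define \<beta> where "\<beta> z = p z * inverse (p z + q z)" for z
  show ?thesis
  proof
    show "smooth \<beta>"
      unfolding smooth_def \<beta>_def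
      using pos by (intro allI C_k_mult C_k_inverse C_k_add C_pq) (metis less_irrefl)
    show "0 \<le> \<beta> z" for z using nonneg[of z] by (simp add: \<beta>_def)
    show "\<beta> z \<le> 1" for z
      using nonneg[of z] pos[of z] by (simp add: \<beta>_def field_simps)
    have "\<beta> z = 1" if "z \<in> ball u (e / 2)" for z
    proof -
      have "(dist u z)\<^sup>2 < (e / 2)\<^sup>2" using that by (intro power_strict_mono) auto
      then have "q z = 0" by (simp add: q_def flat_def s)
      then show ?thesis using pos[of z] by (simp add: \<beta>_def)
    qed
    moreover have "\<forall>\<^sub>F z in nhds u. z \<in> ball u (e / 2)"
      using assms by (intro eventually_nhds_in_open) auto
    ultimately show "\<forall>\<^sub>F z in nhds u. \<beta> z = 1" by (auto elim: eventually_mono)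
    show "\<beta> z = 0" if "z \<notin> cball u e" for z
    proof -
      have "e\<^sup>2 \<le> (dist u z)\<^sup>2" using that assms by (intro power_mono) auto
      then show ?thesis by (simp add: \<beta>_def p_def flat_def s)
    qed
  qed
qed


section \<open>Test functions\<close>

lemma test_functionsI:
  assumes "smooth g" "compact K" "K \<subseteq> frame_bundle" "\<And>u. u \<notin> K \<Longrightarrow> g u = 0"
  shows "g \<in> test_functions"
  using assms unfolding test_functions_def by blast

lemma test_functions_0: "(\<lambda>_. 0) \<in> test_functions"
  by (rule test_functionsI[where K = "{}"]) (auto simp: smooth_def C_k_const)

lemma test_functions_add:
  assumes "g \<in> test_functions" "h \<in> test_functions"
  shows "(\<lambda>u. g u + h u) \<in> test_functions"
proof -
  from assms obtain K L where
    "smooth g" "compact K" "K \<subseteq> frame_bundle" "\<forall>u. u \<notin> K \<longrightarrow> g u = 0"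
    "smooth h" "compact L" "L \<subseteq> frame_bundle" "\<forall>u. u \<notin> L \<longrightarrow> h u = 0"
    unfolding test_functions_def by blast
  then show ?thesis
    by (intro test_functionsI[where K = "K \<union> L"]) (auto simp: smooth_def intro: C_k_add)
qed

lemma test_functions_mult:
  assumes "smooth g" "h \<in> test_functions"
  shows "(\<lambda>u. g u * h u) \<in> test_functions"
  using assms unfolding test_functions_def smooth_def by (auto intro: C_k_mult)

text \<open>\<^const>\<open>frechet_derivative\<close> is chosen among the derivatives at \<open>x\<close>, and the two functions have
  the same ones, possibly none.\<close>

lemma frechet_derivative_cong_nhds:
  assumes "\<forall>\<^sub>F z in nhds x. f z = g z"
  shows "frechet_derivative f (at x) = frechet_derivative g (at x)"
proof -
  obtain d where d: "d > 0" "\<And>z. dist z x < d \<Longrightarrow> f z = g z"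
    using assms by (auto simp: eventually_nhds_metric)
  have "(f has_derivative D) (at x) \<longleftrightarrow> (g has_derivative D) (at x)" for D
    using d by (auto intro: has_derivative_transform_within[where d = d])
  then show ?thesis by (simp add: frechet_derivative_def)
qed

text \<open>The common shape of the horizontal fields \<^const>\<open>vector_X\<close> and the vertical fields
  \<^const>\<open>vector_Y\<close>, whose coefficients are linear in the coordinates.\<close>

definition vector_field ::
  "('n::finite \<Rightarrow> 'n coord \<Rightarrow> real) \<Rightarrow> ('n \<Rightarrow> 'n coord) \<Rightarrow> ('n coord \<Rightarrow> complex) \<Rightarrow> 'n coord \<Rightarrow> complex"
  where "vector_field a v g = (\<lambda>z. \<Sum>\<mu>\<in>UNIV. of_real (a \<mu> z) * frechet_derivative g (at z) (v \<mu>))"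

lemma vector_X_eq:
  "vector_X k = vector_field (\<lambda>\<mu> z. snd z $ \<mu> $ k) (\<lambda>\<mu>. (axis \<mu> 1, 0))"
  by (auto simp: vector_X_def vector_field_def fun_eq_iff)

lemma vector_Y_eq:
  "vector_Y i j = vector_field (\<lambda>\<mu> z. snd z $ \<mu> $ i) (\<lambda>\<mu>. (0, axis \<mu> (axis j 1)))"
  by (auto simp: vector_Y_def vector_field_def fun_eq_iff)

lemma bounded_linear_snd_nth_nth: "bounded_linear (\<lambda>z. snd z $ \<mu> $ k)"
  by (intro bounded_linear_compose[OF bounded_linear_vec_nth] bounded_linear_snd)

lemma vector_field_eventually_const:
  assumes "\<forall>\<^sub>F z in nhds u. g z = c"
  shows "\<forall>\<^sub>F z in nhds u. vector_field a v g z = 0"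
proof -
  from assms have "\<forall>\<^sub>F z in nhds u. \<forall>\<^sub>F z' in nhds z. g z' = c"
    by (simp add: eventually_eventually)
  then show ?thesis
    by eventually_elim (simp add: vector_field_def frechet_derivative_cong_nhds[of g "\<lambda>_. c"])
qed

lemma test_functions_vector_field:
  assumes "g \<in> test_functions" and a: "\<And>\<mu>. bounded_linear (a \<mu>)"
  shows "vector_field a v g \<in> test_functions"
proof -
  from assms obtain K where K:
    "smooth g" "compact K" "K \<subseteq> frame_bundle" "\<And>u. u \<notin> K \<Longrightarrow> g u = 0"
    unfolding test_functions_def by blast
  show ?thesis
  proof (rule test_functionsI[OF _ K(2,3)])
    have "C_k k (\<lambda>z. frechet_derivative g (at z) (v \<mu>))" for k \<mu>
      using K(1) unfolding smooth_def by (metis C_k.simps(2))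
    then show "smooth (vector_field a v g)"
      unfolding smooth_def vector_field_def
      by (intro allI C_k_sum C_k_mult C_k_bounded_linear_compose[OF bounded_linear_of_real])
        (auto intro: C_k_bounded_linear a)
    fix u assume "u \<notin> K"
    then have "\<forall>\<^sub>F z in nhds u. z \<in> - K"
      using K(2) by (intro eventually_nhds_in_open) (auto simp: compact_imp_closed)
    then have "\<forall>\<^sub>F z in nhds u. g z = 0" by eventually_elim (simp add: K(4))
    from vector_field_eventually_const[OF this, THEN eventually_nhds_x_imp_x]
    show "vector_field a v g u = 0" by simp
  qed
qed

lemma test_functions_vector_X: "g \<in> test_functions \<Longrightarrow> vector_X k g \<in> test_functions"
  unfolding vector_X_eq
  by (rule test_functions_vector_field) (auto intro: bounded_linear_snd_nth_nth)

lemma test_functions_vector_Y: "g \<in> test_functions \<Longrightarrow> vector_Y i j g \<in> test_functions"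
  unfolding vector_Y_eq
  by (rule test_functions_vector_field) (auto intro: bounded_linear_snd_nth_nth)

section \<open>The counit\<close>

lemma monomial_add: "monomial p \<phi> + monomial q \<phi> = monomial (\<lambda>u. p u + q u) \<phi>"
  by (intro ext) (simp add: monomial_def)

lemma monomial_scaleC: "c *\<^sub>C monomial p \<phi> = monomial (\<lambda>u. c * p u) \<phi>"
  by (intro ext) (simp add: monomial_def scaleC_fun_def scaleC_complex_def)

lemma monomial_id_in_crossed_product:
  assumes "g \<in> test_functions"
  shows "monomial g id \<in> crossed_product"
proof -
  have "{\<phi>. monomial g id \<phi> \<noteq> 0} \<subseteq> {id}" by (auto simp: monomial_def)
  moreover have "id \<in> diffeomorphisms"
    unfolding diffeomorphisms_def smooth_def
    by (auto simp: id_def[symmetric] inv_id intro: C_k_bounded_linear bounded_linear_ident[folded id_def])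
  moreover have "0 \<in> test_functions"
    using test_functions_0 by (simp add: zero_fun_def)
  ultimately show ?thesis
    using assms unfolding crossed_product_def
    by (auto simp: monomial_def intro: finite_subset)
qed

text \<open>The Jacobian of the identity is constant. The operators \<^const>\<open>op_delta\<close> therefore kill all
  \<open>g U\<^sub>i\<^sub>d\<^sup>*\<close>.\<close>

lemma gamma_id: "gamma i j k id u = 0"
proof -
  have "jacobian id (at x) = mat 1" for x :: "real^'a"
  proof -
    have "frechet_derivative id (at x) = id"
      by (rule frechet_derivative_at[symmetric]) (simp add: id_def)
    then show ?thesis by (simp add: jacobian_def matrix_id_mat_1)
  qed
  then show ?thesis
    by (simp add: gamma_def case_prod_unfold)
qed

text \<open>The condition says that \<open>T 1 = e 1\<close> in terms of functions that are locally constant. The constant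
  \<open>c\<close> is arbitrary, and \<open>g'\<close> is again a test function, so that the condition passes to composites.\<close>

definition acts_on_unit_by :: "'n::finite operator \<Rightarrow> complex \<Rightarrow> bool" where
  "acts_on_unit_by T e \<longleftrightarrow> (\<forall>g\<in>test_functions. \<exists>g'\<in>test_functions.
     T (monomial g id) = monomial g' id \<and>
     (\<forall>u c. (\<forall>\<^sub>F v in nhds u. g v = c) \<longrightarrow> (\<forall>\<^sub>F v in nhds u. g' v = e * c)))"

lemma acts_on_unit_byD:
  assumes "acts_on_unit_by T e" "g \<in> test_functions"
  shows "\<exists>g'. g' \<in> test_functions \<and> T (monomial g id) = monomial g' id \<and>
    (\<forall>u c. (\<forall>\<^sub>F v in nhds u. g v = c) \<longrightarrow> (\<forall>\<^sub>F v in nhds u. g' v = e * c))"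
  using assms unfolding acts_on_unit_by_def by blast

lemma op_X_monomial:
  "g \<in> test_functions \<Longrightarrow> op_X k (monomial g id) = monomial (vector_X k g) id"
  by (rule ext) (simp add: op_X_def on_crossed_product_def monomial_id_in_crossed_product,
    auto simp: monomial_def vector_X_def zero_fun_def)

lemma op_Y_monomial:
  "g \<in> test_functions \<Longrightarrow> op_Y i j (monomial g id) = monomial (vector_Y i j g) id"
  by (rule ext) (simp add: op_Y_def on_crossed_product_def monomial_id_in_crossed_product,
    auto simp: monomial_def vector_Y_def zero_fun_def)

lemma op_delta_monomial:
  "g \<in> test_functions \<Longrightarrow> op_delta i j k (monomial g id) = monomial (\<lambda>_. 0) id"
  by (intro ext) (simp add: op_delta_def on_crossed_product_def monomial_id_in_crossed_product,
    simp add: monomial_def gamma_id)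

text \<open>Vector fields kill locally constant functions and the \<open>\<delta>\<close> operators kill everything over the
  identity, so that \<open>e = 0\<close> on these generators. The number \<open>e\<close> is linear and multiplicative in the
  operator.\<close>

lemma CM_operators_act_on_unit: "T \<in> CM_operators \<Longrightarrow> \<exists>e. acts_on_unit_by T e"
proof (induction rule: CM_operators.induct)
  case one
  have "acts_on_unit_by (on_crossed_product id) 1"
    by (auto simp: acts_on_unit_by_def on_crossed_product_def monomial_id_in_crossed_product)
  then show ?case ..
next
  case (X k)
  have "acts_on_unit_by (op_X k) 0"
    unfolding acts_on_unit_by_def
  proof (intro ballI bexI conjI allI impI)
    fix g :: "'a coord \<Rightarrow> complex" assume g: "g \<in> test_functions"
    show "op_X k (monomial g id) = monomial (vector_X k g) id" by (rule op_X_monomial[OF g])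
    show "vector_X k g \<in> test_functions" by (rule test_functions_vector_X[OF g])
    show "\<forall>\<^sub>F v in nhds u. vector_X k g v = 0 * c" if "\<forall>\<^sub>F v in nhds u. g v = c" for u c
      using vector_field_eventually_const[OF that] by (simp add: vector_X_eq)
  qed
  then show ?case ..
next
  case (Y i j)
  have "acts_on_unit_by (op_Y i j) 0"
    unfolding acts_on_unit_by_def
  proof (intro ballI bexI conjI allI impI)
    fix g :: "'a coord \<Rightarrow> complex" assume g: "g \<in> test_functions"
    show "op_Y i j (monomial g id) = monomial (vector_Y i j g) id" by (rule op_Y_monomial[OF g])
    show "vector_Y i j g \<in> test_functions" by (rule test_functions_vector_Y[OF g])
    show "\<forall>\<^sub>F v in nhds u. vector_Y i j g v = 0 * c" if "\<forall>\<^sub>F v in nhds u. g v = c" for u c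
      using vector_field_eventually_const[OF that] by (simp add: vector_Y_eq)
  qed
  then show ?case ..
next
  case (delta i j k)
  have "acts_on_unit_by (op_delta i j k) 0"
    unfolding acts_on_unit_by_def
    using op_delta_monomial test_functions_0 by fastforce
  then show ?case ..
next
  case (add S T)
  then obtain d e where S: "acts_on_unit_by S d" and T: "acts_on_unit_by T e" by blast
  have "acts_on_unit_by (S + T) (d + e)"
    unfolding acts_on_unit_by_def
  proof
    fix g :: "'a coord \<Rightarrow> complex" assume g: "g \<in> test_functions"
    obtain p where p: "p \<in> test_functions" "S (monomial g id) = monomial p id"
      "\<forall>u c. (\<forall>\<^sub>F v in nhds u. g v = c) \<longrightarrow> (\<forall>\<^sub>F v in nhds u. p v = d * c)"
      using acts_on_unit_byD[OF S g] by blast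
    obtain q where q: "q \<in> test_functions" "T (monomial g id) = monomial q id"
      "\<forall>u c. (\<forall>\<^sub>F v in nhds u. g v = c) \<longrightarrow> (\<forall>\<^sub>F v in nhds u. q v = e * c)"
      using acts_on_unit_byD[OF T g] by blast
    show "\<exists>g'\<in>test_functions. (S + T) (monomial g id) = monomial g' id \<and>
        (\<forall>u c. (\<forall>\<^sub>F v in nhds u. g v = c) \<longrightarrow> (\<forall>\<^sub>F v in nhds u. g' v = (d + e) * c))"
    proof (intro bexI conjI allI impI)
      show "(\<lambda>u. p u + q u) \<in> test_functions" by (rule test_functions_add[OF p(1) q(1)])
      show "(S + T) (monomial g id) = monomial (\<lambda>u. p u + q u) id"
        by (simp add: p(2) q(2) monomial_add)
      fix u c assume "\<forall>\<^sub>F v in nhds u. g v = c"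
      from p(3)[rule_format, OF this] q(3)[rule_format, OF this]
      show "\<forall>\<^sub>F v in nhds u. p v + q v = (d + e) * c"
        by eventually_elim (simp add: algebra_simps)
    qed
  qed
  then show ?case ..
next
  case (scale T c)
  then obtain e where T: "acts_on_unit_by T e" by blast
  have "acts_on_unit_by (c *\<^sub>C T) (c * e)"
    unfolding acts_on_unit_by_def
  proof
    fix g :: "'a coord \<Rightarrow> complex" assume g: "g \<in> test_functions"
    obtain q where q: "q \<in> test_functions" "T (monomial g id) = monomial q id"
      "\<forall>u c. (\<forall>\<^sub>F v in nhds u. g v = c) \<longrightarrow> (\<forall>\<^sub>F v in nhds u. q v = e * c)"
      using acts_on_unit_byD[OF T g] by blast
    show "\<exists>g'\<in>test_functions. (c *\<^sub>C T) (monomial g id) = monomial g' id \<and>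
        (\<forall>u b. (\<forall>\<^sub>F v in nhds u. g v = b) \<longrightarrow> (\<forall>\<^sub>F v in nhds u. g' v = c * e * b))"
    proof (intro bexI conjI allI impI)
      show "(\<lambda>u. c * q u) \<in> test_functions"
        by (rule test_functions_mult[OF _ q(1)]) (simp add: smooth_def C_k_const)
      show "(c *\<^sub>C T) (monomial g id) = monomial (\<lambda>u. c * q u) id"
        by (simp add: scaleC_fun_def[of c T] q(2) monomial_scaleC)
      fix u b assume "\<forall>\<^sub>F v in nhds u. g v = b"
      from q(3)[rule_format, OF this] show "\<forall>\<^sub>F v in nhds u. c * q v = c * e * b"
        by eventually_elim simp
    qed
  qed
  then show ?case ..
next
  case (comp S T)
  then obtain d e where S: "acts_on_unit_by S d" and T: "acts_on_unit_by T e" by blast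
  have "acts_on_unit_by (S \<circ> T) (d * e)"
    unfolding acts_on_unit_by_def
  proof
    fix g :: "'a coord \<Rightarrow> complex" assume g: "g \<in> test_functions"
    obtain q where q: "q \<in> test_functions" "T (monomial g id) = monomial q id"
      "\<forall>u c. (\<forall>\<^sub>F v in nhds u. g v = c) \<longrightarrow> (\<forall>\<^sub>F v in nhds u. q v = e * c)"
      using acts_on_unit_byD[OF T g] by blast
    obtain p where p: "p \<in> test_functions" "S (monomial q id) = monomial p id"
      "\<forall>u c. (\<forall>\<^sub>F v in nhds u. q v = c) \<longrightarrow> (\<forall>\<^sub>F v in nhds u. p v = d * c)"
      using acts_on_unit_byD[OF S q(1)] by blast
    have "\<forall>\<^sub>F v in nhds u. p v = d * e * c" if "\<forall>\<^sub>F v in nhds u. g v = c" for u c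
      using p(3)[rule_format, OF q(3)[rule_format, OF that]] by (simp add: mult.assoc)
    with p(1,2) q(2)
    show "\<exists>g'\<in>test_functions. (S \<circ> T) (monomial g id) = monomial g' id \<and>
        (\<forall>u c. (\<forall>\<^sub>F v in nhds u. g v = c) \<longrightarrow> (\<forall>\<^sub>F v in nhds u. g' v = d * e * c))"
      by auto
  qed
  then show ?case ..
qed

text \<open>The last property gives a function that agrees with the coordinate \<open>y\<^sup>k\<^sub>k\<close> near the standard
  frame, where that coordinate is \<open>1\<close>, and has no zero anywhere; \<open>straightening_coordinate\<close> divides
  by it.\<close>

lemma cutoff_near_standard_frame:
  fixes k :: "'n::finite"
  obtains \<beta> :: "'n coord \<Rightarrow> real" where
    "smooth \<beta>" "(\<lambda>z. complex_of_real (\<beta> z)) \<in> test_functions"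
    "\<forall>\<^sub>F z in nhds (0, mat 1). \<beta> z = 1"
    "\<And>z. \<beta> z * snd z $ k $ k + (1 - \<beta> z) > 0"
proof -
  let ?u = "(0, mat 1) :: 'n coord"
  define S :: "'n coord set" where "S = {z. det (snd z) \<noteq> 0} \<inter> {z. 0 < snd z $ k $ k}"
  have "open S"
    unfolding S_def det_def
    by (intro open_Int open_Collect_neq open_Collect_less continuous_intros)
  moreover have "?u \<in> S" by (simp add: S_def) (simp add: mat_def)
  ultimately obtain e where e: "e > 0" "cball ?u e \<subseteq> S"
    using open_contains_cball by blast
  obtain \<beta> :: "'n coord \<Rightarrow> real" where \<beta>: "smooth \<beta>" "\<And>z. 0 \<le> \<beta> z" "\<And>z. \<beta> z \<le> 1"
    "\<forall>\<^sub>F z in nhds ?u. \<beta> z = 1" "\<And>z. z \<notin> cball ?u e \<Longrightarrow> \<beta> z = 0"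
    using smooth_cutoff[OF e(1)] by blast
  show ?thesis
  proof
    show "smooth \<beta>" by fact
    have "S \<subseteq> frame_bundle" by (auto simp: S_def frame_bundle_def invertible_det_nz)
    then show "(\<lambda>z. complex_of_real (\<beta> z)) \<in> test_functions"
      using \<beta> e(2)
      by (intro test_functionsI[where K = "cball ?u e"])
        (auto simp: smooth_def intro: C_k_bounded_linear_compose[OF bounded_linear_of_real])
    show "\<forall>\<^sub>F z in nhds ?u. \<beta> z = 1" by fact
    fix z
    show "\<beta> z * snd z $ k $ k + (1 - \<beta> z) > 0"
    proof (cases "\<beta> z = 0")
      case False
      then have "z \<in> cball ?u e" using \<beta>(5) by blast
      with e(2) have "0 < snd z $ k $ k" by (auto simp: S_def)
      moreover have "\<beta> z > 0" using False \<beta>(2)[of z] by simp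
      ultimately show ?thesis using \<beta>(3)[of z] by (simp add: add_pos_nonneg)
    qed simp
  qed
qed

text \<open>The number \<open>e\<close> provided by \<open>CM_operators_act_on_unit\<close> meets the defining condition of the
  counit. A cutoff function shows that no other number does.\<close>

lemma acts_on_unit_by_CM_counit: "acts_on_unit_by (operator_of h) (CM_counit h)"
proof -
  obtain e where e: "acts_on_unit_by (operator_of h) e"
    using CM_operators_act_on_unit[OF operator_of] by blast
  have val: "operator_of h (monomial \<eta> id) \<psi> u = monomial (\<lambda>_. e) id \<psi> u"
    if \<eta>: "\<eta> \<in> test_functions" and one: "\<forall>\<^sub>F v in nhds u. \<eta> v = 1" for \<eta> u \<psi>
  proof -
    obtain g where g: "operator_of h (monomial \<eta> id) = monomial g id"
      "\<forall>u c. (\<forall>\<^sub>F v in nhds u. \<eta> v = c) \<longrightarrow> (\<forall>\<^sub>F v in nhds u. g v = e * c)"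
      using acts_on_unit_byD[OF e \<eta>] by blast
    from eventually_nhds_x_imp_x[OF g(2)[rule_format, OF one]] have "g u = e" by simp
    then show ?thesis unfolding g(1) by (simp add: monomial_def)
  qed
  have "CM_counit h = e"
    unfolding CM_counit_def
  proof (rule the_equality)
    fix e'
    assume *: "\<forall>\<eta>\<in>test_functions. \<forall>u\<in>frame_bundle. (\<forall>\<^sub>F v in nhds u. \<eta> v = 1) \<longrightarrow>
       (\<forall>\<psi>. operator_of h (monomial \<eta> id) \<psi> u = monomial (\<lambda>_. e') id \<psi> u)"
    obtain \<beta> :: "'a coord \<Rightarrow> real" where \<beta>: "(\<lambda>z. complex_of_real (\<beta> z)) \<in> test_functions"
      "\<forall>\<^sub>F z in nhds (0, mat 1). \<beta> z = 1"
      using cutoff_near_standard_frame[of "undefined :: 'a"] by blast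
    from \<beta>(2) have one: "\<forall>\<^sub>F z in nhds (0, mat 1). complex_of_real (\<beta> z) = 1"
      by eventually_elim simp
    have "(0, mat 1) \<in> (frame_bundle :: 'a coord set)"
      by (simp add: frame_bundle_def invertible_det_nz)
    from *[rule_format, OF \<beta>(1) this one, of id] val[OF \<beta>(1) one, of id]
    show "e' = e" by (simp add: monomial_def)
  qed (use val in blast)
  with e show ?thesis by simp
qed


section \<open>Polynomials in a horizontal vector field\<close>

text \<open>As \<open>X\<^sub>k\<close> maps \<open>x\<^sup>k\<close> to \<open>y\<^sup>k\<^sub>k\<close> and kills all functions of \<open>y\<close>, it maps \<open>x\<^sup>k / y\<^sup>k\<^sub>k\<close> to \<open>1\<close>.
  The denominator is changed away from the standard frame so that the quotient is smooth everywhere.\<close>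

lemma straightening_coordinate:
  fixes k :: "'n::finite"
  obtains t \<beta> :: "'n coord \<Rightarrow> complex" where
    "smooth t" "\<beta> \<in> test_functions"
    "\<forall>\<^sub>F z in nhds (0, mat 1). \<beta> z = 1"
    "\<forall>\<^sub>F z in nhds (0, mat 1). vector_X k t z = 1"
proof -
  obtain \<beta> :: "'n coord \<Rightarrow> real" where \<beta>:
    "smooth \<beta>" "(\<lambda>z. complex_of_real (\<beta> z)) \<in> test_functions"
    "\<forall>\<^sub>F z in nhds (0, mat 1). \<beta> z = 1"
    "\<And>z. \<beta> z * snd z $ k $ k + (1 - \<beta> z) > 0"
    using cutoff_near_standard_frame by blast
  define r where "r z = \<beta> z * snd z $ k $ k + (1 + - \<beta> z)" for z
  have r0: "r z \<noteq> 0" for z using \<beta>(4)[of z] by (simp add: r_def)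
  define t where "t z = complex_of_real (fst z $ k * inverse (r z))" for z
  show ?thesis
  proof
    have fst: "bounded_linear (\<lambda>z::'n coord. fst z $ k)"
      by (intro bounded_linear_compose[OF bounded_linear_vec_nth] bounded_linear_fst)
    have "C_k m \<beta>" for m using \<beta>(1) by (simp add: smooth_def)
    then have C_r: "C_k m r" for m
      unfolding r_def
      by (intro C_k_add C_k_mult C_k_const C_k_uminus C_k_bounded_linear[OF bounded_linear_snd_nth_nth])
    show "smooth t"
      unfolding smooth_def t_def
      by (intro allI C_k_bounded_linear_compose[OF bounded_linear_of_real] C_k_mult C_k_inverse
          C_r C_k_bounded_linear[OF fst] r0)
    show "(\<lambda>z. complex_of_real (\<beta> z)) \<in> test_functions" by fact
    show "\<forall>\<^sub>F z in nhds (0, mat 1). complex_of_real (\<beta> z) = 1"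
      using \<beta>(3) by eventually_elim simp
    have "\<forall>\<^sub>F z in nhds (0, mat 1). \<forall>\<^sub>F z' in nhds z. \<beta> z' = 1"
      using \<beta>(3) by (simp add: eventually_eventually)
    then show "\<forall>\<^sub>F z in nhds (0, mat 1). vector_X k t z = 1"
    proof eventually_elim
      fix z :: "'n coord" assume near: "\<forall>\<^sub>F z' in nhds z. \<beta> z' = 1"
      have nz: "snd z $ k $ k \<noteq> 0"
        using r0[of z] eventually_nhds_x_imp_x[OF near] by (simp add: r_def)
      let ?t = "\<lambda>z. complex_of_real (fst z $ k * inverse (snd z $ k $ k))"
      let ?D = "\<lambda>h. complex_of_real (fst z $ k * - (inverse (snd z $ k $ k) * snd h $ k $ k *
          inverse (snd z $ k $ k)) + fst h $ k * inverse (snd z $ k $ k))"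
      have "(?t has_derivative ?D) (at z)"
        by (intro bounded_linear.has_derivative[OF bounded_linear_of_real] has_derivative_mult
            Deriv.has_derivative_inverse nz bounded_linear_imp_has_derivative fst bounded_linear_snd_nth_nth)
      moreover have "\<forall>\<^sub>F z' in nhds z. t z' = ?t z'"
        using near by eventually_elim (simp add: t_def r_def)
      then have "frechet_derivative t (at z) = frechet_derivative ?t (at z)"
        by (rule frechet_derivative_cong_nhds)
      ultimately have D: "frechet_derivative t (at z) = ?D"
        using frechet_derivative_at[of ?t ?D z] by (simp only:)
      have "vector_X k t z = (\<Sum>\<mu>\<in>UNIV. if \<mu> = k then
          of_real (snd z $ k $ k) * of_real (inverse (snd z $ k $ k)) else 0)"
        unfolding vector_X_eq vector_field_def D
        by (intro sum.cong) (auto simp: axis_def)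
      then show "vector_X k t z = 1" using nz by (simp flip: of_real_mult)
    qed
  qed
qed

lemma vector_X_coordinate_power:
  assumes t: "smooth t" "\<forall>\<^sub>F z in nhds u. vector_X k t z = 1"
    and g: "\<forall>\<^sub>F z in nhds u. g z = c * t z ^ Suc d"
  shows "\<forall>\<^sub>F z in nhds u. vector_X k g z = (of_nat (Suc d) * c) * t z ^ d"
proof -
  have "\<forall>\<^sub>F z in nhds u. \<forall>\<^sub>F z' in nhds z. g z' = c * t z' ^ Suc d"
    using g by (simp add: eventually_eventually)
  with t(2) show ?thesis
  proof eventually_elim
    fix z assume 1: "vector_X k t z = 1" and g: "\<forall>\<^sub>F z' in nhds z. g z' = c * t z' ^ Suc d"
    have smooth_t: "C_k (Suc 0) t" using t(1) by (simp only: smooth_def)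
    have "((\<lambda>z. c * t z ^ Suc d) has_derivative
        (\<lambda>h. (of_nat (Suc d) * c) * t z ^ d * frechet_derivative t (at z) h)) (at z)"
      by (rule has_derivative_mult_right[OF has_derivative_power, THEN has_derivative_eq_rhs])
        (auto intro: C_k_Suc_has_derivative[OF smooth_t] simp: fun_eq_iff)
    from frechet_derivative_at[OF this] have "frechet_derivative g (at z) =
        (\<lambda>h. (of_nat (Suc d) * c) * t z ^ d * frechet_derivative t (at z) h)"
      using frechet_derivative_cong_nhds[OF g] by (simp only:)
    then have "vector_X k g z = (of_nat (Suc d) * c) * t z ^ d * vector_X k t z"
      by (simp add: vector_X_eq vector_field_def sum_distrib_left mult_ac)
    with 1 show "vector_X k g z = (of_nat (Suc d) * c) * t z ^ d" by simp
  qed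
qed

lemma vector_X_funpow_coordinate_power:
  assumes t: "smooth t" "\<forall>\<^sub>F z in nhds u. vector_X k t z = 1"
  shows "\<forall>\<^sub>F z in nhds u. g z = c * t z ^ d \<Longrightarrow>
    \<forall>\<^sub>F z in nhds u. (vector_X k ^^ d) g z = fact d * c"
proof (induction d arbitrary: g c)
  case (Suc d)
  from Suc.IH[OF vector_X_coordinate_power[OF t Suc.prems]] show ?case
    by (simp add: funpow_swap1 mult_ac)
qed simp

lemma vector_X_funpow_past_const:
  assumes "\<forall>\<^sub>F z in nhds u. (vector_X k ^^ d) g z = c"
  shows "\<forall>\<^sub>F z in nhds u. (vector_X k ^^ (Suc j + d)) g z = 0"
proof (induction j)
  case 0
  then show ?case
    using vector_field_eventually_const[OF assms, folded vector_X_eq] by (simp add: vector_X_eq)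
next
  case (Suc j)
  then show ?case
    using vector_field_eventually_const[OF Suc.IH] by (simp add: vector_X_eq)
qed

lift_definition CM_X :: "'n::finite \<Rightarrow> 'n CM_Hopf" is op_X
  by (rule CM_operators.X)

primrec CM_X_power :: "'n::finite \<Rightarrow> nat \<Rightarrow> 'n CM_Hopf" where
  "CM_X_power k 0 = 1"
| "CM_X_power k (Suc j) = CM_X k * CM_X_power k j"

lemma test_functions_vector_X_funpow:
  "g \<in> test_functions \<Longrightarrow> (vector_X k ^^ j) g \<in> test_functions"
  by (induction j) (auto intro: test_functions_vector_X)

lemma operator_of_one_monomial:
  "g \<in> test_functions \<Longrightarrow> operator_of 1 (monomial g id) = monomial g id"
  by (simp add: one_CM_Hopf.rep_eq on_crossed_product_def monomial_id_in_crossed_product)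

lemma operator_of_CM_X_power:
  assumes "g \<in> test_functions"
  shows "operator_of (CM_X_power k j) (monomial g id) = monomial ((vector_X k ^^ j) g) id"
proof (induction j)
  case 0
  \<comment> \<open>The cases of the induction contain \<open>id\<close> in unfolded form.\<close>
  show ?case using operator_of_one_monomial[OF assms, unfolded id_def] by simp
next
  case (Suc j)
  then show ?case
    using assms
    by (simp add: times_CM_Hopf.rep_eq CM_X.rep_eq test_functions_vector_X_funpow
        op_X_monomial[unfolded id_def])
qed

text \<open>On \<open>g U\<^sub>i\<^sub>d\<^sup>*\<close>, calculations with polynomials in the operator \<open>X\<^sub>k\<close> reduce to calculations
  with the vector field on test functions.\<close>

lemma operator_of_CM_X_polynomial:
  assumes g: "g \<in> test_functions" and "finite J"
  shows "(\<lambda>u. \<Sum>j\<in>J. a j * (vector_X k ^^ j) g u) \<in> test_functions \<and>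
    operator_of (\<Sum>j\<in>J. a j *\<^sub>C CM_X_power k j) (monomial g id) =
      monomial (\<lambda>u. \<Sum>j\<in>J. a j * (vector_X k ^^ j) g u) id"
  using \<open>finite J\<close>
proof (induction J rule: finite_induct)
  case empty
  show ?case
    by (auto simp: test_functions_0 zero_CM_Hopf.rep_eq monomial_def fun_eq_iff)
next
  case (insert j J)
  have "(\<lambda>u. a j * (vector_X k ^^ j) g u) \<in> test_functions"
    by (rule test_functions_mult[OF _ test_functions_vector_X_funpow[OF g]])
      (simp add: smooth_def C_k_const)
  then have tf: "(\<lambda>u. \<Sum>j\<in>insert j J. a j * (vector_X k ^^ j) g u) \<in> test_functions"
    using insert by (simp add: test_functions_add)
  have "operator_of (\<Sum>j\<in>insert j J. a j *\<^sub>C CM_X_power k j) (monomial g id) =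
      a j *\<^sub>C operator_of (CM_X_power k j) (monomial g id) +
      operator_of (\<Sum>j\<in>J. a j *\<^sub>C CM_X_power k j) (monomial g id)"
    by (simp only: sum.insert[OF insert(1,2)] plus_CM_Hopf.rep_eq scaleC_CM_Hopf.rep_eq
        plus_fun_apply scaleC_fun_def[of "a j" "operator_of _"])
  also have "\<dots> = monomial (\<lambda>u. \<Sum>j\<in>insert j J. a j * (vector_X k ^^ j) g u) id"
    by (simp only: operator_of_CM_X_power[OF g] insert.IH[folded id_def] monomial_scaleC monomial_add
        sum.insert[OF insert(1,2)])
  finally show ?case using tf unfolding id_def[symmetric] by blast
qed

text \<open>The polynomial turns a test function equal to \<open>t\<^sup>m\<close> near the standard frame into one that is a
  nonzero constant there: the term of lowest degree contributes \<open>a\<^sub>m m!\<close> and the higher ones nothing.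
  An operator with nonzero counit cannot annihilate the latter.\<close>

lemma CM_counit_eq_0_if_annihilates_polynomial:
  fixes h :: "'a::finite CM_Hopf"
  assumes ann: "h * (\<Sum>j=m..N. a j *\<^sub>C CM_X_power k j) = 0"
    and "m \<le> N" "a m \<noteq> 0"
  shows "CM_counit h = 0"
proof -
  obtain t \<beta> :: "'a coord \<Rightarrow> complex" where t: "smooth t" "\<forall>\<^sub>F z in nhds (0, mat 1). vector_X k t z = 1"
    and \<beta>: "\<beta> \<in> test_functions" "\<forall>\<^sub>F z in nhds (0, mat 1). \<beta> z = 1"
    using straightening_coordinate[of k] by blast
  define w where "w z = t z ^ m * \<beta> z" for z
  have w: "w \<in> test_functions"
    unfolding w_def using t(1) by (intro test_functions_mult \<beta>(1)) (auto simp: smooth_def intro: C_k_power)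
  have "\<forall>\<^sub>F z in nhds (0, mat 1). w z = 1 * t z ^ m"
    using \<beta>(2) by eventually_elim (simp add: w_def)
  from vector_X_funpow_coordinate_power[OF t this]
  have eq_m: "\<forall>\<^sub>F z in nhds (0, mat 1). (vector_X k ^^ m) w z = fact m" by simp
  have gt_m: "\<forall>\<^sub>F z in nhds (0, mat 1). (vector_X k ^^ j) w z = 0" if "j \<in> {m<..N}" for j
  proof -
    from that have "Suc (j - Suc m) + m = j" by simp
    with vector_X_funpow_past_const[OF eq_m, of "j - Suc m"] show ?thesis by (simp only:)
  qed
  define w' where "w' = (\<lambda>z. \<Sum>j=m..N. a j * (vector_X k ^^ j) w z)"
  have w': "w' \<in> test_functions"
    "operator_of (\<Sum>j=m..N. a j *\<^sub>C CM_X_power k j) (monomial w id) = monomial w' id"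
    using operator_of_CM_X_polynomial[OF w, of "{m..N}" a k] by (auto simp: w'_def)
  have "\<forall>\<^sub>F z in nhds (0, mat 1). \<forall>j\<in>{m<..N}. (vector_X k ^^ j) w z = 0"
    using gt_m by (intro eventually_ball_finite) auto
  with eq_m have "\<forall>\<^sub>F z in nhds (0, mat 1). w' z = a m * fact m"
  proof eventually_elim
    case (elim z)
    have "{m..N} = insert m {m<..N}" using \<open>m \<le> N\<close> by auto
    then show ?case using elim by (simp add: w'_def)
  qed
  then obtain g where
    g: "operator_of h (monomial w' id) = monomial g id"
       "\<forall>\<^sub>F z in nhds (0, mat 1). g z = CM_counit h * (a m * fact m)"
    using acts_on_unit_byD[OF acts_on_unit_by_CM_counit[of h] w'(1)] by blast
  have "monomial g id = 0"
    using arg_cong[OF ann, of "\<lambda>h. operator_of h (monomial w id)"]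
    by (simp add: times_CM_Hopf.rep_eq zero_CM_Hopf.rep_eq w'(2) g(1))
  then have "g (0, mat 1) = 0" by (auto simp: monomial_def fun_eq_iff split: if_splits)
  with eventually_nhds_x_imp_x[OF g(2)] \<open>a m \<noteq> 0\<close> show ?thesis by simp
qed


section \<open>Linear dependence in finite dimension\<close>

text \<open>If the first \<open>card B + 1\<close> members are distinct, for a finite spanning set \<open>B\<close>, they are too many to
  be independent; a repetition among them is a relation as well. The index \<open>m\<close> is that of the first nonzero
  coefficient.\<close>

lemma finite_dimensional_relation:
  fixes v :: "nat \<Rightarrow> 'c::complex_vector"
  assumes "finite_dimensional TYPE('c)"
  obtains a m N where "m \<le> N" "a m \<noteq> 0" "(\<Sum>j=m..N. a j *\<^sub>C v j) = 0"
proof -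
  obtain B :: "'c set" where B: "finite B" "complex_vector.span B = UNIV"
    using assms unfolding finite_dimensional_def by blast
  let ?N = "card B"
  have "\<exists>a. (\<exists>j\<le>?N. a j \<noteq> 0) \<and> (\<Sum>j=0..?N. a j *\<^sub>C v j) = 0"
  proof (cases "inj_on v {0..?N}")
    case True
    have "complex_vector.dependent (v ` {0..?N})"
      using complex_vector.independent_span_bound[of B "v ` {0..?N}"] B True
      by (auto simp: card_image)
    then obtain b where "\<exists>x\<in>v ` {0..?N}. b x \<noteq> 0" "(\<Sum>x\<in>v ` {0..?N}. b x *\<^sub>C x) = 0"
      using complex_vector.dependent_finite[of "v ` {0..?N}"] by auto
    with True show ?thesis
      by (intro exI[of _ "\<lambda>j. b (v j)"]) (auto simp: sum.reindex)
  next
    case False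
    then obtain i j where ij: "i \<le> ?N" "j \<le> ?N" "i \<noteq> j" "v i = v j"
      by (auto simp: inj_on_def)
    let ?a = "\<lambda>l. if l = i then 1 else if l = j then -1 else 0 :: complex"
    have "(\<Sum>l=0..?N. ?a l *\<^sub>C v l) = (\<Sum>l\<in>{i, j}. ?a l *\<^sub>C v l)"
      by (rule sum.mono_neutral_right) (use ij in auto)
    also have "\<dots> = 0" using ij by (simp add: complex_vector.scale_one)
    finally show ?thesis using ij by (intro exI[of _ ?a]) auto
  qed
  then obtain a where a: "\<exists>j\<le>?N. a j \<noteq> 0" "(\<Sum>j=0..?N. a j *\<^sub>C v j) = 0" by blast
  define m where "m = (LEAST j. a j \<noteq> 0)"
  have m: "a m \<noteq> 0" "m \<le> ?N"
    using a(1) LeastI[of "\<lambda>j. a j \<noteq> 0"] Least_le[of "\<lambda>j. a j \<noteq> 0"] unfolding m_def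
    by (blast, meson order_trans)
  have "a j = 0" if "j < m" for j using not_less_Least that unfolding m_def by blast
  then have "(\<Sum>j=m..?N. a j *\<^sub>C v j) = (\<Sum>j=0..?N. a j *\<^sub>C v j)"
    by (intro sum.mono_neutral_left) auto
  with a(2) m that show ?thesis by metis
qed

section \<open>Total cointegrals on finite-dimensional module coalgebras\<close>

theorem proposition4p2:
  fixes \<Delta> :: "'c::complex_vector \<Rightarrow> ('c, 'c) tensor"
    and \<epsilon> :: "'c \<Rightarrow> complex"
    and act :: "'c \<Rightarrow> 'n::finite CM_Hopf \<Rightarrow> 'c"
  assumes "right_module_coalgebra \<Delta> \<epsilon> CM_comult CM_counit act"
    and "finite_dimensional TYPE('c)"
    and "\<not> trivial_action CM_counit act"
  shows "\<not> (\<exists>f :: 'c \<Rightarrow> 'n CM_Hopf.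
    total_cointegral CM_counit \<epsilon> act f \<and> coalgebra_map \<Delta> \<epsilon> CM_comult CM_counit f)"
proof
  assume "\<exists>f :: 'c \<Rightarrow> 'n CM_Hopf.
    total_cointegral CM_counit \<epsilon> act f \<and> coalgebra_map \<Delta> \<epsilon> CM_comult CM_counit f"
  then obtain f :: "'c \<Rightarrow> 'n CM_Hopf" where f: "total_cointegral CM_counit \<epsilon> act f"
    by blast
  have lin: "clinear f" and counit: "\<And>c. CM_counit (f c) = \<epsilon> c"
    and right: "\<And>c h. f (act c h) = f c * h"
    using f by (simp_all add: total_cointegral_def)
  have act: "clinear (act c)" for c
    using right_module_coalgebra.cbilinear_act[OF assms(1)] by (simp add: cbilinear_def)
  have counit_left: "tensor_lift (\<lambda>c\<^sub>1 c\<^sub>2. \<epsilon> c\<^sub>1 *\<^sub>C c\<^sub>2) (\<Delta> c) = c" for c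
    using coalgebra.counit_left right_module_coalgebra.axioms(1)[OF assms(1)] by blast
  \<comment> \<open>Any of the operators \<open>X\<^sub>k\<close> will do; the index type is nonempty.\<close>
  fix k :: 'n
  have \<epsilon>: "\<epsilon> c = 0" for c
  proof -
    interpret A: Vector_Spaces.linear scaleC scaleC "act c" by (rule act)
    obtain a m N where a: "m \<le> N" "a m \<noteq> 0" "(\<Sum>j=m..N. a j *\<^sub>C act c (CM_X_power k j)) = 0"
      by (rule finite_dimensional_relation[OF assms(2), of "\<lambda>j. act c (CM_X_power k j)"])
    have "f c * (\<Sum>j=m..N. a j *\<^sub>C CM_X_power k j) = f (act c (\<Sum>j=m..N. a j *\<^sub>C CM_X_power k j))"
      by (simp only: right)
    also have "\<dots> = f 0"
      by (simp only: A.sum A.scale a(3))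
    also have "\<dots> = 0"
      by (rule module_hom.zero) (rule Vector_Spaces.linear.axioms(3)[OF lin])
    finally have "CM_counit (f c) = 0"
      by (rule CM_counit_eq_0_if_annihilates_polynomial) (rule a)+
    then show "\<epsilon> c = 0" by (simp only: counit)
  qed
  have zero: "c = 0" for c :: 'c
    using counit_left[of c] by (simp add: \<epsilon> tensor_lift_def free_lift_def)
  have "act c h = CM_counit h *\<^sub>C c" for c h
    using zero[of "act c h"] zero[of "CM_counit h *\<^sub>C c"] by simp
  then have "trivial_action CM_counit act" by (simp add: trivial_action_def)
  with assms(3) show False by contradiction
qed

end
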